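(* Let $d\ge 2$ and $N\ge 1$ be integers. The optimal success probability $p^*_{\mathrm{EPR}}$ achievable by a probabilistic Port-Based State Preparation protocol for $d$-dimensional states with $N$ ports and with $N$ maximally entangled resource states satisfies $$p^*_{\mathrm{EPR}}\le 1-\left(1-\frac1d\right)^N .$$
   Context: Probabilistic Port-Based State Preparation (PBSP) with maximally entangled resource. Alice holds $N$ qudits $A=A_1\cdots A_N$ and Bob holds $N$ qudits $B=B_1\cdots B_N$ (each register is a copy of $\mathbb{C}^d$). They share the resource state $\rho_{AB}=\bigotimes_{i=1}^N|\phi_d^+\rangle\langle\phi_d^+|_{A_iB_i}$, where $|\phi_d^+\rangle=\frac1{\sqrt d}\sum_{x=1}^d|x\rangle\otimes|x\rangle$. The input is the complete (arbitrarily precise) classical description $\psi$ of a pure state $|\psi\rangle\in\mathbb{C}^d$, known to Alice only. Alice performs on $A$ an $(N+1)$-outcome POVM $\{M_x(\psi)\}_{x=0}^N$, which may depend on $\psi$, and sends the outcome $x$ to Bob. If $x=0$, Bob aborts (failure). If $x\in\{1,\dots,N\}$, Bob traces out all of his registers except $B_x$ (the "port"). A $(d,N,p)$ probabilistic PBSP protocol (with this resource) is a choice of POVMs $\{M_x(\psi)\}_x$ for which, for every input $\psi$: (i) for every $x\in\{1,\dots,N\}$ occurring with nonzero probability, the post-measurement state of port $B_x$ is exactly the desired state, i.e. $\mathrm{Tr}_{A B_{\bar x}}[(M_x(\psi)\otimes I_B)\rho_{AB}] = \mathrm{Tr}[(M_x(\psi)\otimes I_B)\rho_{AB}]\,|\psi\rangle\langle\psi|$,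 where $B_{\bar x}$ denotes all of Bob's registers other than $B_x$; (ii) the success probability is $p$: $1-\mathrm{Tr}[(M_0(\psi)\otimes I_B)\rho_{AB}] = p$. $p^*_{\mathrm{EPR}}$ is the supremum of all $p$ for which a $(d,N,p)$ probabilistic PBSP protocol with this maximally entangled resource exists. *)

theory Defs
  imports "HOL-Analysis.Analysis"
begin

text \<open>
  The type parameters \<open>'d\<close> and \<open>'n\<close> are the computational basis of one
  qudit and the set of ports, so \<open>d = CARD('d)\<close> and \<open>N = CARD('n)\<close>.  The registers
  \<open>A = (A\<^sub>i)\<^sub>i\<close> and \<open>B = (B\<^sub>i)\<^sub>i\<close> each have the computational basis \<open>'n \<Rightarrow> 'd\<close>: the basis
  vector indexed by \<open>a\<close> is the product over the ports \<open>i\<close> of the basis vectors \<open>a i\<close>.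
\<close>

type_synonym 'i cmat = "complex ^ 'i ^ 'i"

text \<open>Since the scalars are complex, this forces the matrix to be Hermitian.\<close>

definition pos_semidef :: "('i::finite) cmat \<Rightarrow> bool" where
  "pos_semidef M \<longleftrightarrow> (\<forall>v. (\<Sum>i\<in>UNIV. cnj (v $ i) * (M *v v) $ i) \<in> \<real>\<^sub>\<ge>\<^sub>0)"

definition is_povm :: "('x::finite \<Rightarrow> ('i::finite) cmat) \<Rightarrow> bool" where
  "is_povm M \<longleftrightarrow> (\<forall>x. pos_semidef (M x)) \<and> (\<Sum>x\<in>UNIV. M x) = mat 1"

definition proj_of :: "complex ^ 'i \<Rightarrow> ('i::finite) cmat" where
  "proj_of v = (\<chi> i j. v $ i * cnj (v $ j))"

definition tensor_vec :: "complex ^ 'i \<Rightarrow> complex ^ 'j \<Rightarrow> complex ^ ('i::finite \<times> 'j::finite)" where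
  "tensor_vec u v = (\<chi> z. u $ fst z * v $ snd z)"

definition tensor_mat :: "('i::finite) cmat \<Rightarrow> ('j::finite) cmat \<Rightarrow> ('i \<times> 'j) cmat" where
  "tensor_mat P Q = (\<chi> z w. P $ fst z $ fst w * Q $ snd z $ snd w)"

definition max_entangled :: "complex ^ ('d::finite \<times> 'd)" where
  "max_entangled =
     (1 / sqrt (real CARD('d))) *\<^sub>R (\<Sum>x\<in>UNIV. tensor_vec (axis x 1) (axis x 1))"

text \<open>
  The tensor product over the ports \<open>i\<close> of the states of the pairs \<open>A\<^sub>i B\<^sub>i\<close>, with the
  tensor factors regrouped as \<open>A\<close> followed by \<open>B\<close>.
\<close>

definition epr_resource :: "(('n::finite \<Rightarrow> 'd::finite) \<times> ('n \<Rightarrow> 'd)) cmat" where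
  "epr_resource =
     (\<chi> z w. \<Prod>i\<in>UNIV. proj_of max_entangled $ (fst z i, snd z i) $ (fst w i, snd w i))"

text \<open>
  The partial trace over \<open>A\<close> and all of Bob's registers except \<open>B\<^sub>x\<close>.  In entry \<open>(u, v)\<close> the
  basis vectors \<open>b\<close> and \<open>b(x := v)\<close> of \<open>B\<close> have the values \<open>u\<close> and \<open>v\<close> at port \<open>x\<close> and
  agree at all other ports, so \<open>b\<close> enumerates the basis of the registers traced out.
\<close>

definition port_trace ::
    "'n \<Rightarrow> (('n::finite \<Rightarrow> 'd::finite) \<times> ('n \<Rightarrow> 'd)) cmat \<Rightarrow> 'd cmat" where
  "port_trace x R =
     (\<chi> u v. \<Sum>a\<in>UNIV. \<Sum>b\<in>{b. b x = u}. R $ (a, b) $ (a, b(x := v)))"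

text \<open>Alice's outcome is \<open>None\<close> for failure (outcome \<open>0\<close>) and \<open>Some x\<close> for the port \<open>x\<close>.\<close>

definition measured ::
    "('n::finite \<Rightarrow> 'd::finite) cmat \<Rightarrow> (('n \<Rightarrow> 'd) \<times> ('n \<Rightarrow> 'd)) cmat" where
  "measured E = tensor_mat E (mat 1) ** epr_resource"

definition pbsp_protocol ::
    "(complex ^ 'd \<Rightarrow> 'n option \<Rightarrow> ('n::finite \<Rightarrow> 'd::finite) cmat) \<Rightarrow> real \<Rightarrow> bool" where
  "pbsp_protocol M p \<longleftrightarrow>
     (\<forall>\<psi>. norm \<psi> = 1 \<longrightarrow>
        is_povm (M \<psi>) \<and>
        (\<forall>x. let q = trace (measured (M \<psi> (Some x))) in
           q \<noteq> 0 \<longrightarrow>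
             port_trace x (measured (M \<psi> (Some x))) = (\<chi> u v. q * proj_of \<psi> $ u $ v)) \<and>
        1 - trace (measured (M \<psi> None)) = complex_of_real p)"

definition p_opt_EPR :: "'d::finite itself \<Rightarrow> 'n::finite itself \<Rightarrow> real" where
  "p_opt_EPR _ _ =
     Sup {p. \<exists>M :: complex ^ 'd \<Rightarrow> 'n option \<Rightarrow> ('n \<Rightarrow> 'd) cmat. pbsp_protocol M p}"

text \<open>
  The supremum is over a nonempty set that is bounded above, so it is a least upper bound.
\<close>

lemma max_entangled_nth:
  "max_entangled $ (x, y) = (if x = y then complex_of_real (1 / sqrt (real CARD('d))) else 0)"
  for x y :: "'d::finite"
proof -
  have "(\<Sum>k\<in>UNIV. axis k (1::complex) $ x * axis k 1 $ y) = (if x = y then 1 else 0)"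
    by (simp add: axis_def mult_delta_left)
  then show ?thesis
    by (simp add: max_entangled_def tensor_vec_def sum_component scaleR_conv_of_real[where 'a = complex])
qed

lemma epr_resource_nth:
  fixes z w :: "('n::finite \<Rightarrow> 'd::finite) \<times> ('n \<Rightarrow> 'd)"
  shows "epr_resource $ z $ w =
    (if fst z = snd z \<and> fst w = snd w then 1 / of_nat (CARD('d) ^ CARD('n)) else 0)"
proof (cases "fst z = snd z \<and> fst w = snd w")
  case True
  have "complex_of_real (1 / sqrt (real CARD('d))) * complex_of_real (1 / sqrt (real CARD('d)))
      = 1 / of_nat CARD('d)"
    by (simp flip: of_real_mult)
  with True show ?thesis
    by (simp add: epr_resource_def proj_of_def max_entangled_nth power_divide)
next
  case False
  then obtain i where "fst z i \<noteq> snd z i \<or> fst w i \<noteq> snd w i"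
    by (auto simp: fun_eq_iff)
  then have "\<exists>i\<in>UNIV. proj_of max_entangled $ (fst z i, snd z i) $ (fst w i, snd w i) = 0"
    by (intro bexI[of _ i]) (auto simp: proj_of_def max_entangled_nth)
  with False show ?thesis
    by (auto simp: epr_resource_def)
qed

lemma trace_measured:
  fixes E :: "('n::finite \<Rightarrow> 'd::finite) cmat"
  shows "trace (measured E) = trace E / of_nat (CARD('d) ^ CARD('n))"
proof -
  let ?D = "of_nat (CARD('d) ^ CARD('n)) :: complex"
  have "trace (measured E) = (\<Sum>a\<in>UNIV. \<Sum>b\<in>UNIV. \<Sum>a'\<in>UNIV. \<Sum>b'\<in>UNIV.
      E $ a $ a' * (if b = b' then 1 else 0) * (if a' = b' \<and> a = b then 1 / ?D else 0))"
    by (simp add: trace_def measured_def matrix_matrix_mult_def tensor_mat_def mat_def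
        epr_resource_nth sum.cartesian_product' flip: UNIV_Times_UNIV)
  also have "\<dots> = (\<Sum>a\<in>UNIV. \<Sum>b\<in>UNIV. \<Sum>a'\<in>UNIV.
      if a' = b then (if a = b then E $ a $ a' / ?D else 0) else 0)"
    by (intro sum.cong refl) (auto simp: mult_delta_left mult_delta_right)
  also have "\<dots> = trace E / ?D"
    by (simp add: trace_def sum_divide_distrib)
  finally show ?thesis .
qed

lemma pos_semidef_diag:
  assumes "pos_semidef M"
  shows "M $ i $ i \<in> \<real>\<^sub>\<ge>\<^sub>0"
proof -
  have "cnj (axis i 1 $ k) = axis i 1 $ k" for k
    by (simp add: axis_def)
  then have "(\<Sum>k\<in>UNIV. cnj (axis i 1 $ k) * (M *v axis i 1) $ k) = M $ i $ i"
    by (simp add: axis_def matrix_vector_mult_def mult_delta_left mult_delta_right)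
  with assms show ?thesis
    unfolding pos_semidef_def by metis
qed

lemma pbsp_protocol_le_1:
  fixes M :: "complex ^ 'd \<Rightarrow> 'n option \<Rightarrow> ('n::finite \<Rightarrow> 'd::finite) cmat"
  assumes "pbsp_protocol M p"
  shows "p \<le> 1"
proof -
  obtain \<psi> :: "complex ^ 'd" where "norm \<psi> = 1"
    using vector_choose_size[of 1] by auto
  with assms have psd: "pos_semidef (M \<psi> None)"
    and p: "1 - trace (measured (M \<psi> None)) = complex_of_real p"
    by (auto simp: pbsp_protocol_def is_povm_def)
  have "Re (M \<psi> None $ i $ i) \<ge> 0" for i
    using pos_semidef_diag[OF psd, of i] by (auto simp: complex_nonneg_Reals_iff)
  then have "Re (trace (M \<psi> None)) \<ge> 0"
    by (simp add: trace_def sum_nonneg)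
  then have "Re (trace (measured (M \<psi> None))) \<ge> 0"
    unfolding trace_measured Re_divide_of_nat by simp
  moreover have "1 - Re (trace (measured (M \<psi> None))) = p"
    using arg_cong[OF p, of Re] by simp
  ultimately show ?thesis by simp
qed

lemma pbsp_protocol_trivial:
  "pbsp_protocol (\<lambda>_ x. if x = None then mat 1 else 0 :: ('n::finite \<Rightarrow> 'd::finite) cmat) 0"
proof -
  have "pos_semidef (mat 1 :: ('n \<Rightarrow> 'd) cmat)"
    unfolding pos_semidef_def
    by (auto simp: complex_nonneg_Reals_iff intro!: sum_nonneg)
  moreover have "pos_semidef (0 :: ('n \<Rightarrow> 'd) cmat)"
    by (simp add: pos_semidef_def)
  moreover have "trace (0 :: ('n \<Rightarrow> 'd) cmat) = 0"
    by (simp add: trace_def)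
  moreover have "trace (mat 1 :: ('n \<Rightarrow> 'd) cmat) = of_nat (CARD('d) ^ CARD('n))"
    by (simp add: trace_def mat_def card_fun)
  ultimately show ?thesis
    by (simp add: pbsp_protocol_def is_povm_def trace_measured)
qed

end

theory Submission
  imports Defs
begin

text \<open>
  It suffices to test a protocol on a single computational basis state \<open>|k\<rangle>\<close>, where only diagonal
  entries matter.  A maximally entangled resource copies Alice's basis string to Bob, so exactness
  at port \<open>x\<close> forces the diagonal of Alice's effect \<open>M\<^sub>x\<close> to vanish at every string \<open>b\<close> with
  \<open>b\<^sub>x \<noteq> k\<close>.  On the \<open>(d - 1)\<^sup>N\<close> strings avoiding \<open>k\<close> altogether the failure effect therefore has
  diagonal entry \<open>1\<close>, and the failure probability is at least \<open>(d - 1)\<^sup>N / d\<^sup>N\<close>.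
\<close>

text \<open>The resource is the projector onto the normalized sum of the vectors
  \<open>|c c>\<close>, so Bob's string \<open>b\<close> takes the place of Alice's column index in
  \<open>E\<close>.\<close>

lemma measured_nth:
  fixes E :: "('n::finite \<Rightarrow> 'd::finite) cmat"
  shows "measured E $ (a, b) $ (a', b') =
    (if a' = b' then E $ a $ b / of_nat (CARD('d) ^ CARD('n)) else 0)"
proof -
  let ?D = "of_nat (CARD('d) ^ CARD('n)) :: complex"
  have "measured E $ (a, b) $ (a', b') = (\<Sum>c\<in>UNIV. \<Sum>c'\<in>UNIV.
      E $ a $ c * (if b = c' then 1 else 0) * (if c = c' \<and> a' = b' then 1 / ?D else 0))"
    by (simp add: measured_def matrix_matrix_mult_def tensor_mat_def mat_def
        epr_resource_nth sum.cartesian_product' flip: UNIV_Times_UNIV)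
  also have "\<dots> = (\<Sum>c\<in>UNIV. if c = b then (if a' = b' then E $ a $ b / ?D else 0) else 0)"
    by (intro sum.cong refl) (auto simp: mult_delta_left mult_delta_right)
  also have "\<dots> = (if a' = b' then E $ a $ b / ?D else 0)"
    by simp
  finally show ?thesis .
qed

lemma port_trace_measured_diag:
  fixes E :: "('n::finite \<Rightarrow> 'd::finite) cmat"
  shows "port_trace x (measured E) $ u $ u =
    (\<Sum>b | b x = u. E $ b $ b) / of_nat (CARD('d) ^ CARD('n))"
proof -
  let ?D = "of_nat (CARD('d) ^ CARD('n)) :: complex"
  have "port_trace x (measured E) $ u $ u =
      (\<Sum>a\<in>UNIV. \<Sum>b | b x = u. if a = b then E $ b $ b / ?D else 0)"
    unfolding port_trace_def vec_lambda_beta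
    \<comment> \<open>When \<open>b x = u\<close>, the update \<open>b(x := u)\<close> changes
      nothing, so only the terms with \<open>a = b\<close> survive.\<close>
    by (intro sum.cong refl) (auto simp: measured_nth fun_upd_idem)
  also have "\<dots> = (\<Sum>b | b x = u. E $ b $ b / ?D)"
    by (subst sum.swap) simp
  finally show ?thesis
    by (simp add: sum_divide_distrib)
qed

lemma pos_semidef_sum_diag_eq_0:
  assumes "pos_semidef E" and "(\<Sum>b\<in>S. E $ b $ b) = 0" and "b \<in> S"
  shows "E $ b $ b = 0"
proof -
  have nonneg: "Re (E $ c $ c) \<ge> 0" "Im (E $ c $ c) = 0" for c
    using pos_semidef_diag[OF assms(1), of c] by (auto simp: complex_nonneg_Reals_iff)
  have "(\<Sum>c\<in>S. Re (E $ c $ c)) = 0"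
    using arg_cong[OF assms(2), of Re] by simp
  with nonneg assms(3) have "Re (E $ b $ b) = 0"
    by (subst (asm) sum_nonneg_eq_0_iff) auto
  with nonneg show ?thesis
    by (simp add: complex_eq_iff)
qed

text \<open>The target projector has diagonal entry 0 at \<open>b x\<close>, so the nonnegative
  diagonal entries of \<open>E\<close> over all strings sharing that port value sum to 0.\<close>

lemma exact_port_diag_eq_0:
  fixes E :: "('n::finite \<Rightarrow> 'd::finite) cmat"
  assumes psd: "pos_semidef E"
    and exact: "trace (measured E) \<noteq> 0 \<Longrightarrow>
      port_trace x (measured E) = (\<chi> u v. trace (measured E) * proj_of (axis k 1) $ u $ v)"
    and "b x \<noteq> k"
  shows "E $ b $ b = 0"
proof (cases "trace (measured E) = 0")
  \<comment> \<open>Exactness says nothing about an outcome of probability zero, but zero trace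
    already kills the whole diagonal.\<close>
  case True
  then have "(\<Sum>c\<in>UNIV. E $ c $ c) = 0"
    by (simp add: trace_measured) (simp add: trace_def)
  then show ?thesis
    using pos_semidef_sum_diag_eq_0[OF psd] by blast
next
  case False
  have "port_trace x (measured E) $ b x $ b x = 0"
    using assms(3) by (simp add: exact[OF False] proj_of_def axis_def)
  then have "(\<Sum>c | c x = b x. E $ c $ c) = 0"
    by (simp add: port_trace_measured_diag)
  then show ?thesis
    by (rule pos_semidef_sum_diag_eq_0[OF psd]) simp
qed

lemma card_functions_avoiding:
  "card {b :: 'n::finite \<Rightarrow> 'd::finite. \<forall>i. b i \<noteq> k} = (CARD('d) - 1) ^ CARD('n)"
proof -
  have "{b :: 'n \<Rightarrow> 'd. \<forall>i. b i \<noteq> k} = PiE UNIV (\<lambda>_. - {k})"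
    by auto
  then show ?thesis
    by (simp add: card_PiE Compl_eq_Diff_UNIV)
qed

lemma pbsp_protocol_le:
  fixes M :: "complex ^ 'd \<Rightarrow> 'n option \<Rightarrow> ('n::finite \<Rightarrow> 'd::finite) cmat"
  assumes "pbsp_protocol M p"
  shows "p \<le> 1 - (1 - 1 / real CARD('d)) ^ CARD('n)"
proof -
  obtain k :: 'd where True by simp
  define E where "E = M (axis k 1)"
  have povm: "is_povm E"
    and exact: "\<And>x. trace (measured (E (Some x))) \<noteq> 0 \<Longrightarrow> port_trace x (measured (E (Some x))) =
      (\<chi> u v. trace (measured (E (Some x))) * proj_of (axis k 1) $ u $ v)"
    and p: "1 - trace (measured (E None)) = complex_of_real p"
    using assms unfolding pbsp_protocol_def E_def by (auto simp: Let_def norm_axis_1)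
  have psd: "pos_semidef (E x)" for x
    using povm by (simp add: is_povm_def)
  let ?S = "{b :: 'n \<Rightarrow> 'd. \<forall>i. b i \<noteq> k}"
  have fail: "E None $ b $ b = 1" if "b \<in> ?S" for b
  proof -
    \<comment> \<open>A string avoiding \<open>k\<close> disagrees with the target at every port, so
      completeness of the POVM leaves the full weight 1 to \<open>None\<close>.\<close>
    have "E (Some x) $ b $ b = 0" for x
      using that by (intro exact_port_diag_eq_0[OF psd exact]) auto
    moreover have "(\<Sum>x\<in>UNIV. E x) $ b $ b = 1"
      using povm by (simp add: is_povm_def mat_def)
    ultimately show ?thesis
      by (simp add: UNIV_option_conv sum.reindex sum_component)
  qed
  have "real ((CARD('d) - 1) ^ CARD('n)) = (\<Sum>b\<in>?S. Re (E None $ b $ b))"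
    using fail by (simp add: card_functions_avoiding)
  also have "\<dots> \<le> (\<Sum>b\<in>UNIV. Re (E None $ b $ b))"
    using pos_semidef_diag[OF psd]
    by (intro sum_mono2) (auto simp: complex_nonneg_Reals_iff)
  also have "\<dots> = Re (trace (E None))"
    by (simp add: trace_def)
  finally have "real ((CARD('d) - 1) ^ CARD('n)) / real (CARD('d) ^ CARD('n))
      \<le> Re (trace (measured (E None)))"
    unfolding trace_measured Re_divide_of_nat by (rule divide_right_mono) simp
  \<comment> \<open>The subtraction on naturals does not truncate, since \<open>CARD('d)\<close> is
    positive.\<close>
  moreover have "1 - 1 / real CARD('d) = real (CARD('d) - 1) / real CARD('d)"
    by (simp add: of_nat_diff diff_divide_distrib Suc_leI)
  moreover have "p = 1 - Re (trace (measured (E None)))"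
    using arg_cong[OF p, of Re] by simp
  ultimately show ?thesis
    by (simp add: power_divide)
qed

theorem theorem5p3:
  assumes "CARD('d::finite) \<ge> 2" and "CARD('n::finite) \<ge> 1"
  shows "p_opt_EPR TYPE('d) TYPE('n) \<le> 1 - (1 - 1 / real CARD('d)) ^ CARD('n)"
  unfolding p_opt_EPR_def
proof (rule cSup_least)
  \<comment> \<open>\<open>Sup\<close> is controlled by an upper bound only on a nonempty set; the
    protocol that always aborts attains \<open>p = 0\<close>.\<close>
  show "{p. \<exists>M :: complex ^ 'd \<Rightarrow> 'n option \<Rightarrow> ('n \<Rightarrow> 'd) cmat. pbsp_protocol M p} \<noteq> {}"
    using pbsp_protocol_trivial by blast
qed (auto intro: pbsp_protocol_le)

end
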